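(* Consider the linear programs (P) minimize $c^\top x$ subject to $Ax=b$, $x\ge 0$, and (D) maximize $b^\top y$ subject to $A^\top y\le c$, where $A\in\mathbb{R}^{m\times n}$, $b\in\mathbb{R}^m$, $c\in\mathbb{R}^n$. Let $\eta,\tau>0$ satisfy $\eta\tau\|A\|_2^2<1$, let $T$ be the primal-dual hybrid gradient operator with step sizes $\eta,\tau$, let $v=(v_x,v_y)$ be its infimal displacement vector, and let $z^k=(x^k,y^k)$ be generated by $z^{k+1}=T(z^k)$ from an arbitrary $z^0\in\mathbb{R}^{n+m}$. Then one of the following holds: 1. If both (P) and (D) are feasible, then $(x^k,y^k)$ converges to a primal-dual solution $z^\star=(x^\star,y^\star)$, and $v=(T-I)(z^\star)=0$. 2. If both (P) and (D) are infeasible, then both the primal iterates $x^k$ and the dual iterates $y^k$ diverge to infinity. Moreover, $v_x$ is a certificate of dual infeasibility and $v_y$ is a certificate of primal infeasibility. 3. If (P) is infeasible and (D) is feasible, then the dual iterates $y^k$ diverge to infinity, while the primal iterates $x^k$ converge to a vector $x^\star$. The component $v_y$ is a certificate of primal infeasibility. Furthermore, there exists a vector $y^\star$ such that $v=(T-I)(x^\star,y^\star)$. 4. If (P) is feasible and (D) is infeasible, then the primal iterates $x^k$ diverge to infinity, while the dual iterates $y^k$ converge to a vector $y^\star$. The component $v_x$ is a certificate of dual infeasibility. Furthermore, there exists a vector $x^\star$ such that $v=(T-I)(x^\star,y^\star)$.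
   Context: The operator $T:\mathbb{R}^{n+m}\to\mathbb{R}^{n+m}$ is $T(x,y)=(x^+,y^+)$ with $x^+=\mathrm{proj}_{\mathbb{R}^n_+}(x-\eta A^\top y-\eta c)$ and $y^+=y+\tau A(2x^+-x)-\tau b$. Here $\|A\|_2$ is the spectral norm and $\mathrm{proj}_{\mathbb{R}^n_+}$ is the Euclidean projection onto the nonnegative orthant. Let $M=\begin{bmatrix}\frac1\eta I_n & -A^\top\\ -A&\frac1\tau I_m\end{bmatrix}$, which is positive definite when $\eta\tau\|A\|_2^2<1$, and $\|z\|_M=\sqrt{z^\top Mz}$. $T$ is nonexpansive with respect to $\|\cdot\|_M$, the set $\mathrm{cl}(\mathrm{range}(T-I))$ is convex, and the infimal displacement vector $v=(v_x,v_y)\in\mathbb{R}^n\times\mathbb{R}^m$ is its unique element of minimum $\|\cdot\|_M$-norm. A certificate of primal infeasibility is a $y\in\mathbb{R}^m$ with $b^\top y<0$ and $A^\top y\ge0$. A certificate of dual infeasibility is an $x\in\mathbb{R}^n$ with $c^\top x<0$, $Ax=0$, $x\ge0$. A primal-dual solution is a saddle point $(x^\star,y^\star)$ of $\min_{x\ge0}\max_{y\in\mathbb{R}^m}\ c^\top x+\langle Ax,y\rangle-b^\top y$. With this sign convention, this means that $x^\star$ is optimal for (P) and $-y^\star$ is optimal for (D). *)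

theory Defs
  imports "HOL-Analysis.Analysis"
begin

text \<open>
  The inequality \<open>\<le>\<close> on vectors is the componentwise order of HOL-Analysis.
\<close>

definition primal_feasible :: "real^'n^'m \<Rightarrow> real^'m \<Rightarrow> bool" where
  "primal_feasible A b \<longleftrightarrow> (\<exists>x. A *v x = b \<and> 0 \<le> x)"

definition dual_feasible :: "real^'n^'m \<Rightarrow> real^'n \<Rightarrow> bool" where
  "dual_feasible A c \<longleftrightarrow> (\<exists>y. transpose A *v y \<le> c)"

definition primal_infeasibility_certificate ::
    "real^'n^'m \<Rightarrow> real^'m \<Rightarrow> real^'m \<Rightarrow> bool" where
  "primal_infeasibility_certificate A b y \<longleftrightarrow> b \<bullet> y < 0 \<and> 0 \<le> transpose A *v y"

definition dual_infeasibility_certificate ::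
    "real^'n^'m \<Rightarrow> real^'n \<Rightarrow> real^'n \<Rightarrow> bool" where
  "dual_infeasibility_certificate A c x \<longleftrightarrow> c \<bullet> x < 0 \<and> A *v x = 0 \<and> 0 \<le> x"

definition lagrangian ::
    "real^'n^'m \<Rightarrow> real^'m \<Rightarrow> real^'n \<Rightarrow> real^'n \<Rightarrow> real^'m \<Rightarrow> real" where
  "lagrangian A b c x y = c \<bullet> x + (A *v x) \<bullet> y - b \<bullet> y"

text \<open>
  Saddle points of \<open>min\<^bsub>x \<ge> 0\<^esub> max\<^bsub>y\<^esub> lagrangian A b c x y\<close>. With this sign
  convention it is \<open>- y\<close>, not \<open>y\<close>, that solves the dual linear program.
\<close>

definition primal_dual_solution ::
    "real^'n^'m \<Rightarrow> real^'m \<Rightarrow> real^'n \<Rightarrow> (real^'n) \<times> (real^'m) \<Rightarrow> bool" where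
  "primal_dual_solution A b c = (\<lambda>(x', y').
     0 \<le> x' \<and>
     (\<forall>y. lagrangian A b c x' y \<le> lagrangian A b c x' y') \<and>
     (\<forall>x. 0 \<le> x \<longrightarrow> lagrangian A b c x' y' \<le> lagrangian A b c x y'))"

definition pdhg ::
    "real^'n^'m \<Rightarrow> real^'m \<Rightarrow> real^'n \<Rightarrow> real \<Rightarrow> real
      \<Rightarrow> (real^'n) \<times> (real^'m) \<Rightarrow> (real^'n) \<times> (real^'m)" where
  "pdhg A b c \<eta> \<tau> = (\<lambda>(x, y).
     let x' = closest_point {u. 0 \<le> u} (x - \<eta> *\<^sub>R (transpose A *v y) - \<eta> *\<^sub>R c);
         y' = y + \<tau> *\<^sub>R (A *v (2 *\<^sub>R x' - x)) - \<tau> *\<^sub>R b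
     in (x', y'))"

text \<open>
  The block matrix \<open>M\<close> with rows \<open>(1/\<eta> I, -A\<^sup>T)\<close> and \<open>(-A, 1/\<tau> I)\<close>, as an operator on pairs.
\<close>

definition pdhg_M ::
    "real^'n^'m \<Rightarrow> real \<Rightarrow> real \<Rightarrow> (real^'n) \<times> (real^'m) \<Rightarrow> (real^'n) \<times> (real^'m)" where
  "pdhg_M A \<eta> \<tau> = (\<lambda>(x, y).
     ((1 / \<eta>) *\<^sub>R x - transpose A *v y, - (A *v x) + (1 / \<tau>) *\<^sub>R y))"

definition M_norm :: "real^'n^'m \<Rightarrow> real \<Rightarrow> real \<Rightarrow> (real^'n) \<times> (real^'m) \<Rightarrow> real" where
  "M_norm A \<eta> \<tau> z = sqrt (z \<bullet> pdhg_M A \<eta> \<tau> z)"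

definition infimal_displacement ::
    "real^'n^'m \<Rightarrow> real^'m \<Rightarrow> real^'n \<Rightarrow> real \<Rightarrow> real \<Rightarrow> (real^'n) \<times> (real^'m)" where
  "infimal_displacement A b c \<eta> \<tau> =
     (THE v. v \<in> closure (range (\<lambda>z. pdhg A b c \<eta> \<tau> z - z)) \<and>
        (\<forall>w \<in> closure (range (\<lambda>z. pdhg A b c \<eta> \<tau> z - z)). M_norm A \<eta> \<tau> v \<le> M_norm A \<eta> \<tau> w))"

end

theory Submission
  imports Defs
begin

text \<open>
  With \<open>z' = T z\<close> and \<open>w = z' - z\<close>, the equation defining \<open>T\<close> says that \<open>z'\<close> is a KKT point of
  the linear program whose data \<open>(b, c)\<close> are perturbed by \<open>M w\<close>. By strong duality, \<open>w\<close> is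
  therefore a displacement iff the perturbed program is primal and dual feasible, so the set of
  displacements is closed and convex, and \<open>v = T z - z\<close> is attained. The variational inequality
  for the minimal \<open>M\<close>-norm makes nonzero components of \<open>v\<close> infeasibility certificates and gives
  \<open>T (z + k v) = z + (k + 1) v\<close>. The deviation of the iterates from this orbit is Fejer monotone
  by firm nonexpansiveness and has vanishing increments. At a cluster point \<open>p\<close> the defect
  \<open>T (p + k v) - (p + (k + 1) v)\<close> tends to \<open>0\<close> along a subsequence, but as \<open>T\<close> is piecewise affine
  it is eventually affine in \<open>k\<close>, hence eventually \<open>0\<close>. So the deviation from the orbit
  through \<open>p\<close> is eventually monotone too, and it converges to \<open>0\<close>.
\<close>

subsection \<open>Linear programming duality\<close>

declare transpose_matrix_vector [simp del]

lemma inner_transpose: "x \<bullet> (transpose A *v y) = (A *v x) \<bullet> y"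
  for A :: "real^'n^'m"
  by (metis dot_lmul_matrix inner_commute transpose_matrix_vector)

lemma inner_transpose': "(transpose A *v y) \<bullet> x = y \<bullet> (A *v x)"
  for A :: "real^'n^'m"
  by (simp add: inner_transpose inner_commute[of _ x] inner_commute[of y])

lemma nonneg_vec_iff: "0 \<le> x \<longleftrightarrow> (\<forall>i. 0 \<le> x $ i)" for x :: "real^'n"
  by (simp add: less_eq_vec_def)

lemma inner_nonneg_vec: "0 \<le> x \<Longrightarrow> 0 \<le> y \<Longrightarrow> 0 \<le> x \<bullet> y" for x y :: "real^'n"
  by (simp add: nonneg_vec_iff inner_vec_def sum_nonneg)

lemma nonneg_vecI: "(\<And>y. 0 \<le> y \<Longrightarrow> 0 \<le> x \<bullet> y) \<Longrightarrow> 0 \<le> x" for x :: "real^'n"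
proof -
  assume *: "\<And>y. 0 \<le> y \<Longrightarrow> 0 \<le> x \<bullet> y"
  have "0 \<le> x $ i" for i
    using *[of "axis i 1"] by (simp add: inner_axis nonneg_vec_iff) (simp add: axis_def)
  then show ?thesis by (simp add: nonneg_vec_iff)
qed

text \<open>The vector \<open>- q\<close> must lie in the normal cone of the orthant at
  \<open>p\<close>. Writing the projected point as \<open>p - q\<close> makes the projection step of
  \<open>T\<close> a complementarity condition.\<close>

lemma closest_point_orthant_eq_iff:
  fixes p q :: "real^'n"
  shows "closest_point {u. 0 \<le> u} (p - q) = p \<longleftrightarrow> 0 \<le> p \<and> 0 \<le> q \<and> p \<bullet> q = 0"
proof -
  let ?S = "{u :: real^'n. 0 \<le> u}"
  have eq: "?S = {u. \<forall>i. 0 \<le> u $ i}" by (auto simp: nonneg_vec_iff)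
  have cl: "closed ?S"
    by (auto simp: eq intro!: closed_Collect_all closed_Collect_le continuous_intros)
  have co: "convex ?S"
    unfolding eq by (auto simp: convex_def)
  show ?thesis
  proof
    assume L: "closest_point ?S (p - q) = p"
    have p: "0 \<le> p" using closest_point_in_set[OF cl, of "p - q"] L by auto
    have dot: "(p - q - p) \<bullet> (u - p) \<le> 0" if "0 \<le> u" for u
      using closest_point_dot[OF co cl, of u "p - q"] that L by simp
    have "0 \<le> q"
    proof (rule nonneg_vecI)
      fix y :: "real^'n" assume "0 \<le> y"
      then show "0 \<le> q \<bullet> y" using dot[of "p + y"] p by simp
    qed
    moreover have "q \<bullet> p \<le> 0"
      using dot[of "0"] dot[of "2 *\<^sub>R p"] p
      by (simp add: inner_diff_right scaleR_2)
    ultimately show "0 \<le> p \<and> 0 \<le> q \<and> p \<bullet> q = 0"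
      using p inner_nonneg_vec[of p q] by (simp add: inner_commute)
  next
    assume R: "0 \<le> p \<and> 0 \<le> q \<and> p \<bullet> q = 0"
    have "dist (p - q) p \<le> dist (p - q) u" if "0 \<le> u" for u
    proof -
      have "q \<bullet> q \<le> (p - q - u) \<bullet> (p - q - u)"
        using R inner_nonneg_vec[OF that, of q] inner_ge_zero[of "p - u"]
        by (simp add: inner_diff_left inner_diff_right inner_commute)
      then show ?thesis by (simp add: dist_norm norm_le)
    qed
    then show "closest_point ?S (p - q) = p"
      using closest_point_unique[OF co cl, of p "p - q"] R by auto
  qed
qed

text \<open>Positive and negative part of \<open>w\<close> have disjoint supports, hence are
  complementary. The componentwise form exhibits \<open>T\<close> as piecewise affine.\<close>

lemma closest_point_orthant:
  fixes w :: "real^'n"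
  shows "closest_point {u. 0 \<le> u} w = (\<chi> i. max 0 (w $ i))"
proof -
  let ?p = "\<chi> i. max 0 (w $ i)"
  have "closest_point {u. 0 \<le> u} (?p - (?p - w)) = ?p"
    unfolding closest_point_orthant_eq_iff
    by (auto simp: nonneg_vec_iff inner_vec_def max_def intro!: sum.neutral)
  then show ?thesis by simp
qed

text \<open>Orthant times free space is a finitely generated cone, its linear image is again
  finitely generated, and finitely generated cones are closed. This is the source of both Farkas
  separation and the closedness of the set of displacements.\<close>

lemma closed_linear_image_orthant_Times:
  fixes f :: "'a::euclidean_space \<times> 'b::euclidean_space \<Rightarrow> 'c::euclidean_space"
  assumes "linear f"
  shows "closed (f ` ({p. \<forall>e\<in>Basis. 0 \<le> p \<bullet> e} \<times> UNIV))"
proof -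
  let ?P = "{p::'a. \<forall>e\<in>Basis. 0 \<le> p \<bullet> e} \<times> (UNIV::'b set)"
  \<comment> \<open>Generators: all basis vectors, and also the negatives of those of the free
    factor.\<close>
  let ?S = "(Basis :: ('a \<times> 'b) set) \<union> (\<lambda>e. (0, - e)) ` Basis"
  have "convex_cone hull ?S = ?P"
  proof
    show "convex_cone hull ?S \<subseteq> ?P"
    proof (rule hull_minimal)
      show "?S \<subseteq> ?P"
        by (auto simp: Basis_prod_def inner_Basis)
      show "convex_cone ?P"
        by (intro convex_cone_Times) (simp_all add: convex_cone_iff inner_add_left)
    qed
    have sum_in: "sum g I \<in> convex_cone hull ?S"
      if "finite I" "\<And>i. i \<in> I \<Longrightarrow> g i \<in> convex_cone hull ?S" for g and I :: "('a \<times> 'b) set"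
      using that
    proof (induction I rule: finite_induct)
      case empty
      show ?case by (simp add: convex_cone_hull_contains_0)
    next
      case (insert i I)
      then show ?case using convex_cone_hull_add[of "g i" ?S "sum g I"] by simp
    qed
    show "?P \<subseteq> convex_cone hull ?S"
    proof
      fix z assume z: "z \<in> ?P"
      have "(z \<bullet> e) *\<^sub>R e \<in> convex_cone hull ?S" if e: "e \<in> Basis" for e
      proof (cases "0 \<le> z \<bullet> e")
        case True
        then show ?thesis using e by (intro convex_cone_hull_mul hull_inc) auto
      next
        case False
        \<comment> \<open>A negative coordinate can only belong to the free factor, where
          \<open>(0, - e')\<close> is a generator.\<close>
        have "\<forall>u\<in>Basis. 0 \<le> z \<bullet> (u, 0)"
          using z by (simp add: mem_Times_iff inner_prod_def)
        with False have "e \<notin> (\<lambda>u. (u, 0)) ` Basis" by blast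
        then obtain e' where e': "e = (0, e')" "e' \<in> Basis"
          using e unfolding Basis_prod_def by blast
        have "(- (z \<bullet> e)) *\<^sub>R (0, - e') \<in> convex_cone hull ?S"
          using False e' by (intro convex_cone_hull_mul hull_inc) auto
        then show ?thesis using e' by simp
      qed
      then have "(\<Sum>e\<in>Basis. (z \<bullet> e) *\<^sub>R e) \<in> convex_cone hull ?S"
        by (rule sum_in[OF finite_Basis])
      then show "z \<in> convex_cone hull ?S"
        by (simp only: euclidean_representation)
    qed
  qed
  moreover have "f ` (convex_cone hull ?S) = convex_cone hull (f ` ?S)"
    by (rule convex_cone_hull_linear_image[OF assms, symmetric])
  moreover have "closed (convex_cone hull (f ` ?S))"
    by (intro closed_convex_cone_hull finite_imageI finite_UnI finite_Basis)
  ultimately show ?thesis by simp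
qed

section \<open>Closedness and convexity of the sets of feasible data\<close>

lemma Basis_nonneg_vec_iff: "(\<forall>e\<in>Basis. 0 \<le> x \<bullet> e) \<longleftrightarrow> 0 \<le> x" for x :: "real^'n"
  by (auto simp: Basis_vec_def nonneg_vec_iff inner_axis)

text \<open>This is the sign flip of the saddle point convention: the witness here is minus a dual
  feasible point.\<close>

lemma dual_feasible_iff: "dual_feasible A c \<longleftrightarrow> (\<exists>y. 0 \<le> c + transpose A *v y)"
  for A :: "real^'n^'m"
proof -
  have *: "0 \<le> c + transpose A *v (- y) \<longleftrightarrow> transpose A *v y \<le> c" for y
    by (simp add: linear_neg[OF matrix_vector_mul_linear] less_eq_vec_def)
  show ?thesis
  proof
    show "dual_feasible A c \<Longrightarrow> \<exists>y. 0 \<le> c + transpose A *v y"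
      unfolding dual_feasible_def using * by blast
    show "\<exists>y. 0 \<le> c + transpose A *v y \<Longrightarrow> dual_feasible A c"
      unfolding dual_feasible_def using *[of "- _"] by (metis minus_minus)
  qed
qed

lemma closed_primal_feasible: "closed {b. primal_feasible A b}"
  for A :: "real^'n^'m"
proof -
  \<comment> \<open>A \<open>real\<close> coordinate fills the free factor of the image lemma, as
    the primal variables are all sign-constrained.\<close>
  have "linear (\<lambda>p::(real^'n) \<times> real. A *v fst p)"
    by (auto intro!: linearI simp: algebra_simps)
  from closed_linear_image_orthant_Times[OF this]
  have "closed ((\<lambda>p::(real^'n) \<times> real. A *v fst p) ` ({x. 0 \<le> x} \<times> UNIV))"
    unfolding Basis_nonneg_vec_iff .
  also have "(\<lambda>p::(real^'n) \<times> real. A *v fst p) ` ({x. 0 \<le> x} \<times> UNIV) = {b. primal_feasible A b}"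
    by (force simp: primal_feasible_def image_iff)
  finally show ?thesis .
qed

lemma closed_dual_feasible: "closed {c. dual_feasible A c}"
  for A :: "real^'n^'m"
proof -
  \<comment> \<open>The dual slack is the orthant variable and the multiplier is free.\<close>
  let ?f = "\<lambda>p::(real^'n) \<times> (real^'m). fst p + transpose A *v snd p"
  have "linear ?f"
    by (auto intro!: linearI simp: algebra_simps)
  from closed_linear_image_orthant_Times[OF this]
  have "closed (?f ` ({x. 0 \<le> x} \<times> UNIV))"
    unfolding Basis_nonneg_vec_iff .
  also have "?f ` ({x. 0 \<le> x} \<times> UNIV) = {c. dual_feasible A c}"
  proof (intro set_eqI iffI)
    fix c assume "c \<in> {c. dual_feasible A c}"
    then obtain y where "transpose A *v y \<le> c" by (auto simp: dual_feasible_def)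
    then show "c \<in> ?f ` ({x. 0 \<le> x} \<times> UNIV)"
      by (intro image_eqI[of _ _ "(c - transpose A *v y, y)"]) (auto simp: less_eq_vec_def)
  next
    fix c assume "c \<in> ?f ` ({x. 0 \<le> x} \<times> UNIV)"
    then obtain x y where "0 \<le> x" "c = x + transpose A *v y" by auto
    then have "transpose A *v y \<le> c" by (simp add: less_eq_vec_def)
    then show "c \<in> {c. dual_feasible A c}" by (auto simp: dual_feasible_def)
  qed
  finally show ?thesis .
qed

lemma convex_primal_feasible: "convex {b. primal_feasible A b}"
  for A :: "real^'n^'m"
proof (rule convexI)
  fix b b' :: "real^'m" and u v :: real
  assume "b \<in> {b. primal_feasible A b}" "b' \<in> {b. primal_feasible A b}"
    and uv: "0 \<le> u" "0 \<le> v" "u + v = 1"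
  then obtain x x' where x: "A *v x = b" "0 \<le> x" and x': "A *v x' = b'" "0 \<le> x'"
    by (auto simp: primal_feasible_def)
  have "A *v (u *\<^sub>R x + v *\<^sub>R x') = u *\<^sub>R b + v *\<^sub>R b'"
    by (simp add: algebra_simps x x')
  moreover have "0 \<le> u *\<^sub>R x + v *\<^sub>R x'"
    using x x' uv by (simp add: nonneg_vec_iff)
  ultimately show "u *\<^sub>R b + v *\<^sub>R b' \<in> {b. primal_feasible A b}"
    by (auto simp: primal_feasible_def)
qed

lemma convex_dual_feasible: "convex {c. dual_feasible A c}"
  for A :: "real^'n^'m"
proof (rule convexI)
  fix c c' :: "real^'n" and u v :: real
  assume "c \<in> {c. dual_feasible A c}" "c' \<in> {c. dual_feasible A c}"
    and uv: "0 \<le> u" "0 \<le> v" "u + v = 1"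
  then obtain y y' where y: "transpose A *v y \<le> c" and y': "transpose A *v y' \<le> c'"
    by (auto simp: dual_feasible_def)
  have "transpose A *v (u *\<^sub>R y + v *\<^sub>R y') = u *\<^sub>R (transpose A *v y) + v *\<^sub>R (transpose A *v y')"
    by (simp add: algebra_simps)
  also have "\<dots> \<le> u *\<^sub>R c + v *\<^sub>R c'"
    using y y' uv by (simp add: less_eq_vec_def add_mono mult_left_mono)
  finally show "u *\<^sub>R c + v *\<^sub>R c' \<in> {c. dual_feasible A c}"
    by (auto simp: dual_feasible_def)
qed

section \<open>KKT points and strong duality\<close>

text \<open>The vector \<open>c + transpose A *v y\<close> is the slack of the dual point
  \<open>- y\<close>; the last conjunct is complementary slackness.\<close>

definition kkt :: "real^'n^'m \<Rightarrow> real^'m \<Rightarrow> real^'n \<Rightarrow> (real^'n) \<times> (real^'m) \<Rightarrow> bool" where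
  "kkt A b c = (\<lambda>(x, y). 0 \<le> x \<and> A *v x = b \<and> 0 \<le> c + transpose A *v y \<and>
     x \<bullet> (c + transpose A *v y) = 0)"

text \<open>Monotonicity of the saddle point operator. The terms with \<open>A\<close> cancel by
  skew symmetry, and complementarity leaves only minus the pairings of each primal point with the
  other slack. Firm nonexpansiveness of \<open>T\<close> rests on this.\<close>

lemma kkt_monotone:
  fixes A :: "real^'n^'m"
  assumes "kkt A (b + snd p) (c + fst p) z" and "kkt A (b + snd p') (c + fst p') z'"
  shows "(z - z') \<bullet> (p - p') \<le> 0"
proof -
  obtain x y x' y' p1 p2 p1' p2' where
    z: "z = (x, y)" "z' = (x', y')" "p = (p1, p2)" "p' = (p1', p2')"
    by (metis surj_pair)
  let ?s = "c + p1 + transpose A *v y" and ?s' = "c + p1' + transpose A *v y'"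
  have k: "0 \<le> x" "A *v x = b + p2" "0 \<le> ?s" "x \<bullet> ?s = 0"
    "0 \<le> x'" "A *v x' = b + p2'" "0 \<le> ?s'" "x' \<bullet> ?s' = 0"
    using assms by (auto simp: kkt_def z)
  have "p1 - p1' = ?s - ?s' - transpose A *v (y - y')"
    by (simp add: algebra_simps)
  then have "(x - x') \<bullet> (p1 - p1') = (x - x') \<bullet> (?s - ?s') - (A *v (x - x')) \<bullet> (y - y')"
    by (metis inner_diff_right inner_transpose)
  also have "A *v (x - x') = p2 - p2'"
    using k by (simp add: algebra_simps)
  finally have "(z - z') \<bullet> (p - p') = (x - x') \<bullet> (?s - ?s')"
    by (simp add: z inner_prod_def inner_commute)
  also have "\<dots> = - (x \<bullet> ?s') - x' \<bullet> ?s"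
    using k(4,8) by (simp only: inner_diff_left inner_diff_right)
  finally show ?thesis
    using inner_nonneg_vec[OF k(1,7)] inner_nonneg_vec[OF k(5,3)] by linarith
qed

text \<open>At \<open>x\<close> the Lagrangian is constant in the dual variable because
  \<open>A *v x = b\<close>. At \<open>y\<close> it is, up to a constant, the pairing with a
  nonnegative slack, which attains its minimum 0 at \<open>x\<close>.\<close>

lemma kkt_imp_primal_dual_solution:
  fixes A :: "real^'n^'m"
  assumes "kkt A b c z"
  shows "primal_dual_solution A b c z"
proof -
  obtain x y where z: "z = (x, y)" by fastforce
  have k: "0 \<le> x" "A *v x = b" "0 \<le> c + transpose A *v y" "x \<bullet> (c + transpose A *v y) = 0"
    using assms by (auto simp: kkt_def z)
  have L: "lagrangian A b c x' y = x' \<bullet> (c + transpose A *v y) - b \<bullet> y" for x'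
    by (simp add: lagrangian_def inner_add_right inner_transpose inner_commute[of c])
  have "lagrangian A b c x y' \<le> lagrangian A b c x y" for y'
    by (simp add: lagrangian_def k(2))
  moreover have "lagrangian A b c x y \<le> lagrangian A b c x' y" if "0 \<le> x'" for x'
    unfolding L using k(4) inner_nonneg_vec[OF that k(3)] by simp
  ultimately show ?thesis
    using k(1) by (simp add: primal_dual_solution_def z)
qed

text \<open>
  Strong duality by Farkas: since a KKT point has no duality gap, its existence is membership of
  \<open>(b, c, 0)\<close> in a closed convex cone.
\<close>

lemma ex_kkt_iff:
  fixes A :: "real^'n^'m"
  shows "(\<exists>z. kkt A b c z) \<longleftrightarrow> primal_feasible A b \<and> dual_feasible A c"
proof
  assume "\<exists>z. kkt A b c z"
  then obtain x y where k: "0 \<le> x" "A *v x = b" "0 \<le> c + transpose A *v y"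
    by (auto simp: kkt_def)
  then show "primal_feasible A b \<and> dual_feasible A c"
    by (auto simp: primal_feasible_def dual_feasible_iff)
next
  assume "primal_feasible A b \<and> dual_feasible A c"
  then obtain x0 y0 where x0: "A *v x0 = b" "0 \<le> x0" and y0: "0 \<le> c + transpose A *v y0"
    by (auto simp: primal_feasible_def dual_feasible_iff)
  \<comment> \<open>Here \<open>s\<close> is the dual slack and \<open>t\<close> relaxes the duality
    gap: third entry 0 says that the gap \<open>c \<bullet> x + b \<bullet> y\<close> is at most 0,
    and weak duality turns this into equality.\<close>
  let ?f = "\<lambda>((x, s, t), y). (A *v x, s - transpose A *v y, c \<bullet> x + b \<bullet> y + t)"
  let ?P = "{p::(real^'n) \<times> (real^'n) \<times> real. \<forall>e\<in>Basis. 0 \<le> p \<bullet> e}"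
  have P: "(x, s, t) \<in> ?P \<longleftrightarrow> 0 \<le> x \<and> 0 \<le> s \<and> 0 \<le> t" for x s t
    unfolding Basis_nonneg_vec_iff[symmetric]
    by (simp add: Basis_prod_def ball_Un ball_simps(9) conj_ac)
  have lin: "linear ?f"
    by (intro linearI)
      (simp_all add: split_beta matrix_vector_right_distrib matrix_vector_mult_scaleR
        scaleR_diff_right inner_add_right distrib_left)
  define K where "K = ?f ` (?P \<times> UNIV)"
  have cl: "closed K"
    unfolding K_def by (rule closed_linear_image_orthant_Times[OF lin])
  have "convex_cone (?P \<times> (UNIV :: (real^'m) set))"
    by (simp add: convex_cone_iff inner_add_left mem_Times_iff)
  then have cone: "convex_cone K"
    unfolding K_def using convex_cone_linear_image lin by blast
  have K: "(A *v x, s - transpose A *v y, c \<bullet> x + b \<bullet> y + t) \<in> K"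
    if "0 \<le> x" "0 \<le> s" "0 \<le> t" for x s t y
    unfolding K_def using that P[of x s t]
    by (intro image_eqI[of _ _ "((x, s, t), y)"]) (simp_all add: mem_Times_iff)
  have "convex K" and 0: "0 \<in> K"
    using cone by (simp_all add: convex_cone_def convex_cone_contains_0)
  have "(b, c, 0) \<in> K"
  proof (rule ccontr)
    assume "(b, c, 0) \<notin> K"
    then obtain a \<beta> where a: "a \<bullet> (b, c, 0) < \<beta>" "\<And>q. q \<in> K \<Longrightarrow> \<beta> < a \<bullet> q"
      using separating_hyperplane_closed_point[OF \<open>convex K\<close> cl] by metis
    have "\<beta> < 0" using a(2)[OF 0] by simp
    then have neg: "a \<bullet> (b, c, 0) < 0" using a(1) by simp
    \<comment> \<open>A separating functional is nonnegative on a cone: if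
      \<open>a \<bullet> q\<close> were negative, rescaling \<open>q\<close> would attain the value
      \<open>\<beta>\<close>, which the strict bound excludes.\<close>
    have pos: "0 \<le> a \<bullet> q" if q: "q \<in> K" for q
    proof (rule ccontr)
      assume "\<not> 0 \<le> a \<bullet> q"
      with \<open>\<beta> < 0\<close> have "0 \<le> \<beta> / (a \<bullet> q)"
        by (simp add: divide_nonpos_nonpos)
      then have "\<beta> < a \<bullet> ((\<beta> / (a \<bullet> q)) *\<^sub>R q)"
        using a(2) convex_cone_scaleR[OF cone _ q] by blast
      then show False using \<open>\<not> 0 \<le> a \<bullet> q\<close> by simp
    qed
    obtain u w r where auwr: "a = (u, w, r)" by (metis surj_pair)
    have sep: "0 \<le> u \<bullet> (A *v x) + w \<bullet> (s - transpose A *v y) + r * (c \<bullet> x + b \<bullet> y + t)"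
      if "0 \<le> x" "0 \<le> s" "0 \<le> t" for x s t y
      using pos[OF K[OF that, of y]] by (simp add: auwr add.assoc)
    \<comment> \<open>Testing one variable at a time makes \<open>w\<close> and \<open>u\<close>
      primal and dual feasible for the data scaled by \<open>r\<close>.\<close>
    have r: "0 \<le> r" using sep[of 0 0 1 0] by simp
    have w: "0 \<le> w"
    proof (rule nonneg_vecI)
      show "0 \<le> w \<bullet> s" if "0 \<le> s" for s using sep[of 0 s 0 0] that by simp
    qed
    have u: "0 \<le> transpose A *v u + r *\<^sub>R c"
    proof (rule nonneg_vecI)
      show "0 \<le> (transpose A *v u + r *\<^sub>R c) \<bullet> x" if "0 \<le> x" for x
        using sep[of x 0 0 0] that by (simp add: inner_add_left inner_transpose')
    qed
    have Aw: "A *v w = r *\<^sub>R b"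
    proof -
      let ?e = "A *v w - r *\<^sub>R b"
      have "0 \<le> - (?e \<bullet> y)" for y
        using sep[of 0 0 0 y] by (simp add: inner_diff_left inner_transpose)
      from this[of ?e] have "?e \<bullet> ?e = 0"
        using inner_ge_zero[of ?e] by linarith
      then show ?thesis by (simp only: inner_eq_zero_iff right_minus_eq)
    qed
    have wu: "w \<bullet> (transpose A *v u + r *\<^sub>R c) = r * (b \<bullet> u + w \<bullet> c)"
      by (simp add: inner_add_right inner_transpose Aw distrib_left)
    have bc: "b \<bullet> u + w \<bullet> c < 0" using neg by (simp add: auwr inner_commute)
    show False
    \<comment> \<open>For \<open>r \<noteq> 0\<close>, weak duality for the scaled data contradicts
      \<open>bc\<close>. For \<open>r = 0\<close>, \<open>w\<close> and \<open>u\<close> are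
      recession directions, and pairing them with \<open>y0\<close> and \<open>x0\<close> makes both
      terms of \<open>bc\<close> nonnegative.\<close>
    proof (cases "r = 0")
      case False
      then have "r * (b \<bullet> u + w \<bullet> c) < 0"
        using r bc mult_pos_neg[of r "b \<bullet> u + w \<bullet> c"] by linarith
      then show False using inner_nonneg_vec[OF w u] wu by simp
    next
      case True
      have "0 \<le> x0 \<bullet> (transpose A *v u)" 
        using inner_nonneg_vec[OF x0(2) u] True by simp
      moreover have "0 \<le> w \<bullet> (c + transpose A *v y0)" using inner_nonneg_vec[OF w y0] .
      ultimately show False
        using bc x0 Aw True by (simp add: inner_add_right inner_transpose)
    qed
  qed
  then obtain p y where py: "p \<in> ?P" "(b, c, 0) = ?f (p, y)"
    unfolding K_def by blast
  obtain x s t where xst: "p = (x, s, t)" by (metis surj_pair)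
  have e: "b = A *v x" "c = s - transpose A *v y" "0 = c \<bullet> x + b \<bullet> y + t"
    using py(2) unfolding xst prod.case prod.inject by blast+
  have "(x, s, t) \<in> ?P" using py(1) by (simp only: xst)
  then have p: "0 \<le> x" "0 \<le> s" "0 \<le> t" using P by blast+
  have s: "c + transpose A *v y = s" by (simp add: e(2))
  have "x \<bullet> (c + transpose A *v y) = c \<bullet> x + b \<bullet> y"
    by (simp add: inner_add_right inner_transpose e(1) inner_commute[of x c])
  then have "x \<bullet> (c + transpose A *v y) = 0"
    using inner_nonneg_vec[OF p(1,2)] p(3) e(3) unfolding s by linarith
  then have "kkt A b c (x, y)"
    using p s e(1) by (simp only: kkt_def prod.case simp_thms)
  then show "\<exists>z. kkt A b c z" by blast
qed

subsection \<open>Affine sequences\<close>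

text \<open>Consecutive indices of a subsequence differ by at least 1, so the values eventually
  change by at least \<open>\<bar>\<beta>\<bar>\<close> per step. A null subsequence therefore kills
  the slope, and then the constant.\<close>

lemma eventually_affine_tendsto_0:
  fixes f :: "nat \<Rightarrow> real"
  assumes aff: "\<forall>\<^sub>F k in sequentially. f k = \<alpha> + real k * \<beta>"
    and r: "strict_mono r" and lim: "(\<lambda>j. f (r j)) \<longlonglongrightarrow> 0"
  shows "\<forall>\<^sub>F k in sequentially. f k = 0"
proof -
  have aff_r: "\<forall>\<^sub>F j in sequentially. f (r j) = \<alpha> + real (r j) * \<beta>"
    using eventually_compose_filterlim[OF aff filterlim_subseq[OF r]] .
  have aff_Suc: "\<forall>\<^sub>F j in sequentially. f (r (Suc j)) = \<alpha> + real (r (Suc j)) * \<beta>"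
    using aff_r by (subst (asm) eventually_sequentially_Suc[symmetric])
  have "(\<lambda>j. \<bar>f (r (Suc j)) - f (r j)\<bar>) \<longlonglongrightarrow> \<bar>0 - 0\<bar>"
    using lim by (intro tendsto_intros LIMSEQ_Suc)
  moreover have "\<forall>\<^sub>F j in sequentially. \<bar>\<beta>\<bar> \<le> \<bar>f (r (Suc j)) - f (r j)\<bar>"
    using aff_r aff_Suc
  proof eventually_elim
    case (elim j)
    have "r j + 1 \<le> r (Suc j)" using r by (simp add: Suc_le_eq strict_mono_Suc_iff)
    then have "1 \<le> real (r (Suc j)) - real (r j)" by linarith
    then have "1 * \<bar>\<beta>\<bar> \<le> \<bar>real (r (Suc j)) - real (r j)\<bar> * \<bar>\<beta>\<bar>"
      by (intro mult_right_mono) auto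
    then show ?case by (simp add: elim left_diff_distrib abs_mult[symmetric])
  qed
  ultimately have "\<bar>\<beta>\<bar> \<le> \<bar>0 - 0\<bar>"
    by (rule tendsto_lowerbound) simp
  then have "\<beta> = 0" by simp
  then have "(\<lambda>j. f (r j)) \<longlonglongrightarrow> \<alpha>"
    using aff_r by (intro tendsto_eventually) simp
  then have "\<alpha> = 0" using lim LIMSEQ_unique by blast
  with \<open>\<beta> = 0\<close> show ?thesis using aff by simp
qed

text \<open>For \<open>g \<noteq> 0\<close> the sign of the argument no longer changes once
  \<open>k\<close> has passed the breakpoint \<open>- a / g\<close>.\<close>

lemma eventually_max_0_affine:
  "\<exists>\<alpha> \<beta>. \<forall>\<^sub>F k in sequentially. max 0 (a + real k * g) = \<alpha> + real k * \<beta>" for a g :: real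
proof -
  consider "g = 0" | "g > 0" | "g < 0" by linarith
  then show ?thesis
  proof cases
    case 1
    then show ?thesis by (intro exI[of _ "max 0 a"] exI[of _ 0]) simp
  next
    case 2
    have "\<forall>\<^sub>F k in sequentially. - a / g \<le> real k"
      using filterlim_real_sequentially by (simp add: filterlim_at_top)
    then have "\<forall>\<^sub>F k in sequentially. max 0 (a + real k * g) = a + real k * g"
      by eventually_elim (use 2 in \<open>simp add: pos_divide_le_eq max_def del: divide_minus_left\<close>)
    then show ?thesis by blast
  next
    case 3
    have "\<forall>\<^sub>F k in sequentially. - a / g \<le> real k"
      using filterlim_real_sequentially by (simp add: filterlim_at_top)
    then have "\<forall>\<^sub>F k in sequentially. max 0 (a + real k * g) = 0 + real k * 0"
      by eventually_elim (use 3 in \<open>simp add: neg_divide_le_eq max_def del: divide_minus_left\<close>)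
    then show ?thesis by blast
  qed
qed

lemma filterlim_at_infinity_linear_drift:
  fixes x :: "nat \<Rightarrow> 'a::real_normed_vector"
  assumes "(\<lambda>k. x k - real k *\<^sub>R a) \<longlonglongrightarrow> l" and "a \<noteq> 0"
  shows "filterlim x at_infinity sequentially"
proof -
  have "filterlim (\<lambda>k. norm a * real k) at_top sequentially"
    using assms(2)
    by (intro filterlim_tendsto_pos_mult_at_top[OF tendsto_const] filterlim_real_sequentially) simp
  then have "filterlim (\<lambda>k. real k *\<^sub>R a) at_infinity sequentially"
    by (intro filterlim_norm_at_top_imp_at_infinity) (simp add: mult.commute)
  from tendsto_add_filterlim_at_infinity[OF assms(1) this] show ?thesis by simp
qed

subsection \<open>Minimising a coercive quadratic form\<close>

text \<open>Abstracts the geometry of the \<open>M\<close>-norm. In finite dimension coercivity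
  amounts to positive definiteness; the explicit constant serves to compare with the Euclidean
  norm.\<close>

locale coercive_operator =
  fixes M :: "'a::euclidean_space \<Rightarrow> 'a"
  assumes linear_M: "linear M"
    and symmetric: "u \<bullet> M v = M u \<bullet> v"
    and coercive: "\<exists>\<epsilon>>0. \<forall>u. \<epsilon> * (norm u)\<^sup>2 \<le> u \<bullet> M u"
begin

lemma nonneg: "0 \<le> u \<bullet> M u"
proof -
  obtain \<epsilon> where "\<epsilon> > 0" "\<epsilon> * (norm u)\<^sup>2 \<le> u \<bullet> M u" using coercive by blast
  moreover from this have "0 \<le> \<epsilon> * (norm u)\<^sup>2" by simp
  ultimately show ?thesis by linarith
qed

lemma eq_0: "u \<bullet> M u \<le> 0 \<Longrightarrow> u = 0"
proof -
  assume u: "u \<bullet> M u \<le> 0"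
  obtain \<epsilon> where "\<epsilon> > 0" "\<epsilon> * (norm u)\<^sup>2 \<le> u \<bullet> M u" using coercive by blast
  then have "\<epsilon> * (norm u)\<^sup>2 \<le> 0" using u by linarith
  then have "(norm u)\<^sup>2 \<le> 0"
    using \<open>\<epsilon> > 0\<close> by (simp add: mult_le_0_iff)
  then show "u = 0" by simp
qed

lemma form_add: "(u + v) \<bullet> M (u + v) = u \<bullet> M u + 2 * (u \<bullet> M v) + v \<bullet> M v"
  using symmetric[of u v]
  by (simp add: linear_add[OF linear_M] inner_add_left inner_add_right inner_commute)

lemma bounded_form: "\<exists>K. \<forall>u. u \<bullet> M u \<le> a \<longrightarrow> norm u \<le> K"
proof -
  obtain \<epsilon> where \<epsilon>: "\<epsilon> > 0" "\<And>u. \<epsilon> * (norm u)\<^sup>2 \<le> u \<bullet> M u" using coercive by blast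
  have "norm u \<le> sqrt (a / \<epsilon>)" if "u \<bullet> M u \<le> a" for u
    using \<epsilon>(1) order_trans[OF \<epsilon>(2) that]
    by (intro real_le_rsqrt) (simp add: pos_le_divide_eq mult.commute)
  then show ?thesis by blast
qed

lemma continuous_form: "continuous_on S (\<lambda>u. u \<bullet> M u)"
  using linear_continuous_on_compose[OF continuous_on_id linear_M]
  by (intro continuous_intros) auto

lemma tendsto_0_iff: "((\<lambda>k. d k \<bullet> M (d k)) \<longlongrightarrow> 0) F \<longleftrightarrow> (d \<longlongrightarrow> 0) F"
proof
  assume L: "((\<lambda>k. d k \<bullet> M (d k)) \<longlongrightarrow> 0) F"
  obtain \<epsilon> where \<epsilon>: "\<epsilon> > 0" "\<And>u. \<epsilon> * (norm u)\<^sup>2 \<le> u \<bullet> M u" using coercive by blast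
  have "((\<lambda>k. sqrt ((d k \<bullet> M (d k)) / \<epsilon>)) \<longlongrightarrow> sqrt (0 / \<epsilon>)) F"
    using \<epsilon>(1) by (intro tendsto_intros L) simp
  moreover have "norm (d k) \<le> sqrt ((d k \<bullet> M (d k)) / \<epsilon>)" for k
    using \<epsilon> by (intro real_le_rsqrt) (simp add: pos_le_divide_eq mult.commute)
  ultimately show "(d \<longlongrightarrow> 0) F"
    by (intro Lim_null_comparison[of d "\<lambda>k. sqrt ((d k \<bullet> M (d k)) / \<epsilon>)"]) simp_all
next
  assume d: "(d \<longlongrightarrow> 0) F"
  have "((\<lambda>k. d k \<bullet> M (d k)) \<longlongrightarrow> 0 \<bullet> M 0) F"
    by (intro tendsto_inner d bounded_linear.tendsto[OF linear_M[unfolded linear_conv_bounded_linear]])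
  then show "((\<lambda>k. d k \<bullet> M (d k)) \<longlongrightarrow> 0) F" by simp
qed

text \<open>By coercivity the sublevel set of any point \<open>w0\<close> of \<open>C\<close> is
  bounded, so a minimum over a compact part of \<open>C\<close> is global.\<close>

lemma ex_minimizer:
  assumes "closed C" "C \<noteq> {}"
  obtains v where "v \<in> C" "\<And>w. w \<in> C \<Longrightarrow> v \<bullet> M v \<le> w \<bullet> M w"
proof -
  obtain w0 where w0: "w0 \<in> C" using assms by blast
  obtain K where K: "\<And>u. u \<bullet> M u \<le> w0 \<bullet> M w0 \<Longrightarrow> norm u \<le> K" using bounded_form by blast
  have "compact (C \<inter> cball 0 K)" "C \<inter> cball 0 K \<noteq> {}"
    using assms w0 K by (auto intro!: closed_Int_compact)
  then obtain v where v: "v \<in> C \<inter> cball 0 K" "\<And>w. w \<in> C \<inter> cball 0 K \<Longrightarrow> v \<bullet> M v \<le> w \<bullet> M w"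
    using continuous_attains_inf[OF _ _ continuous_form] by metis
  have "v \<bullet> M v \<le> w \<bullet> M w" if "w \<in> C" for w
  proof (cases "w \<in> cball 0 K")
    case False
    then have "w0 \<bullet> M w0 < w \<bullet> M w" using K[of w] by force
    moreover have "v \<bullet> M v \<le> w0 \<bullet> M w0" using v(2)[of w0] w0 K[of w0] by simp
    ultimately show ?thesis by simp
  qed (use v(2) that in auto)
  then show thesis using that v(1) by blast
qed

text \<open>First-order optimality: on the segment from \<open>v\<close> to \<open>w\<close> the
  form is quadratic in the parameter, with initial slope twice the stated product.\<close>

lemma minimizer_variational_inequality:
  assumes "convex C" "v \<in> C" "w \<in> C" and min: "\<And>w. w \<in> C \<Longrightarrow> v \<bullet> M v \<le> w \<bullet> M w"
  shows "0 \<le> v \<bullet> M (w - v)"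
proof (rule ccontr)
  define a q where "a = v \<bullet> M (w - v)" and "q = (w - v) \<bullet> M (w - v)"
  assume "\<not> 0 \<le> v \<bullet> M (w - v)"
  then have a: "a < 0" by (simp add: a_def)
  have q: "0 \<le> q" using nonneg by (simp add: q_def)
  \<comment> \<open>Chosen so that \<open>t * q \<le> - a\<close>, whence the linear term
    \<open>2 * a\<close> dominates; the \<open>+ 1\<close> covers \<open>q = 0\<close>.\<close>
  define t where "t = min 1 (- a / (q + 1))"
  have t: "0 < t" "t \<le> 1" using a q by (auto simp: t_def divide_neg_pos)
  have "t \<le> - a / (q + 1)" by (simp add: t_def)
  then have "t * (q + 1) \<le> - a" using q by (simp add: pos_le_divide_eq del: divide_minus_left)
  then have tq: "t * q \<le> - a" using t by (simp add: distrib_left)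
  have "v + t *\<^sub>R (w - v) \<in> C"
    using convexD_alt[OF assms(1-3), of t] t by (simp add: algebra_simps)
  from min[OF this] have "0 \<le> 2 * (t * a) + t * (t * q)"
    by (simp add: form_add linear_scale[OF linear_M] a_def q_def)
  also have "\<dots> = t * (2 * a + t * q)" by (simp add: algebra_simps)
  also have "\<dots> < 0" using t a tq by (intro mult_pos_neg) auto
  finally show False by simp
qed

lemma minimizer_unique:
  assumes "convex C" "v \<in> C" "v' \<in> C"
    and "\<And>w. w \<in> C \<Longrightarrow> v \<bullet> M v \<le> w \<bullet> M w" and "\<And>w. w \<in> C \<Longrightarrow> v' \<bullet> M v' \<le> w \<bullet> M w"
  shows "v = v'"
proof -
  have "0 \<le> v \<bullet> M (v' - v)" "0 \<le> v' \<bullet> M (v - v')"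
    using assms minimizer_variational_inequality by blast+
  moreover have "v' \<bullet> M (v - v') = - (v' \<bullet> M (v' - v))"
    using linear_neg[OF linear_M, of "v' - v"] by simp
  ultimately have "(v' - v) \<bullet> M (v' - v) \<le> 0"
    by (simp add: inner_diff_left)
  from eq_0[OF this] show ?thesis by simp
qed

text \<open>Every perturbation of the data is thus of the form \<open>M w\<close>, so minimality can
  be tested with arbitrary feasible data.\<close>

lemma surj_M: "surj M"
proof (rule linear_injective_imp_surjective[OF linear_M _ refl])
  show "inj M"
    by (auto simp: linear_injective_0[OF linear_M] intro: eq_0)
qed

end

subsection \<open>The primal-dual hybrid gradient operator\<close>

locale pdhg_steps =
  fixes A :: "real^'n^'m" and b :: "real^'m" and c :: "real^'n" and \<eta> \<tau> :: real
  assumes eta: "\<eta> > 0" and tau: "\<tau> > 0" and step: "\<eta> * \<tau> * (onorm ((*v) A))\<^sup>2 < 1"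
begin

abbreviation "M \<equiv> pdhg_M A \<eta> \<tau>"
abbreviation "T \<equiv> pdhg A b c \<eta> \<tau>"

section \<open>The metric \<open>M\<close> and the resolvent form of \<open>T\<close>\<close>

lemma fst_M: "fst (M u) = (1 / \<eta>) *\<^sub>R fst u - transpose A *v snd u"
  and snd_M: "snd (M u) = (1 / \<tau>) *\<^sub>R snd u - A *v fst u"
  by (simp_all add: pdhg_M_def split_beta)

lemma inner_M: "u \<bullet> M v = (fst u \<bullet> fst v) / \<eta> - (A *v fst u) \<bullet> snd v - (A *v fst v) \<bullet> snd u + (snd u \<bullet> snd v) / \<tau>"
  by (simp add: inner_prod_def fst_M snd_M inner_diff_right inner_transpose inner_commute[of "snd u"])

sublocale coercive_operator M
proof (rule coercive_operator.intro)
  show "linear M"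
    by (rule linearI)
      (simp_all add: prod_eq_iff fst_M snd_M algebra_simps)
  show "u \<bullet> M v = M u \<bullet> v" for u v
    by (subst inner_commute[of "M u"]) (simp add: inner_M inner_commute)
  define L where "L = onorm ((*v) A)"
  have L: "norm (A *v x) \<le> L * norm x" for x
    unfolding L_def by (rule onorm) (simp add: matrix_vector_mul_bounded_linear)
  have L0: "0 \<le> L" unfolding L_def by (rule onorm_pos_le) (simp add: matrix_vector_mul_bounded_linear)
  \<comment> \<open>After scaling by the square roots of the step sizes, the cross term is at most
    \<open>\<rho>\<close> times the sum of the two squares, which leaves the fraction
    \<open>1 - \<rho>\<close> of the diagonal part.\<close>
  define \<rho> where "\<rho> = L * (sqrt \<eta> * sqrt \<tau>)"
  have "\<rho>\<^sup>2 < 1\<^sup>2"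
    using step eta tau by (simp add: \<rho>_def power_mult_distrib L_def mult_ac)
  then have \<rho>: "\<rho> < 1" using power2_less_imp_less[of \<rho> 1] by simp
  have \<rho>0: "0 \<le> \<rho>" using L0 eta tau by (simp add: \<rho>_def)
  let ?\<epsilon> = "(1 - \<rho>) * min (1 / \<eta>) (1 / \<tau>)"
  have "?\<epsilon> * (norm u)\<^sup>2 \<le> u \<bullet> M u" for u
  proof -
    define \<xi> \<zeta> where "\<xi> = norm (fst u) / sqrt \<eta>" and "\<zeta> = norm (snd u) / sqrt \<tau>"
    have \<xi>: "(norm (fst u))\<^sup>2 / \<eta> = \<xi>\<^sup>2" and \<zeta>: "(norm (snd u))\<^sup>2 / \<tau> = \<zeta>\<^sup>2"
      using eta tau by (simp_all add: \<xi>_def \<zeta>_def power_divide)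
    have "(A *v fst u) \<bullet> snd u \<le> norm (A *v fst u) * norm (snd u)"
      by (rule norm_cauchy_schwarz)
    also have "\<dots> \<le> L * norm (fst u) * norm (snd u)"
      by (intro mult_right_mono L) simp
    also have "\<dots> = \<rho> * (\<xi> * \<zeta>)"
      using eta tau by (simp add: \<rho>_def \<xi>_def \<zeta>_def)
    finally have "2 * ((A *v fst u) \<bullet> snd u) \<le> \<rho> * (2 * \<xi> * \<zeta>)" by simp
    also have "\<dots> \<le> \<rho> * (\<xi>\<^sup>2 + \<zeta>\<^sup>2)"
      by (intro mult_left_mono sum_squares_bound \<rho>0)
    finally have *: "(1 - \<rho>) * (\<xi>\<^sup>2 + \<zeta>\<^sup>2) \<le> u \<bullet> M u"
      by (simp add: inner_M dot_square_norm \<xi> \<zeta> algebra_simps)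
    have "min (1 / \<eta>) (1 / \<tau>) * (norm u)\<^sup>2 =
        min (1 / \<eta>) (1 / \<tau>) * (norm (fst u))\<^sup>2 + min (1 / \<eta>) (1 / \<tau>) * (norm (snd u))\<^sup>2"
      by (simp add: norm_prod_def distrib_left)
    also have "\<dots> \<le> (1 / \<eta>) * (norm (fst u))\<^sup>2 + (1 / \<tau>) * (norm (snd u))\<^sup>2"
      by (intro add_mono mult_right_mono) auto
    also have "\<dots> = \<xi>\<^sup>2 + \<zeta>\<^sup>2" by (simp add: \<xi>[symmetric] \<zeta>[symmetric])
    finally have "(1 - \<rho>) * (min (1 / \<eta>) (1 / \<tau>) * (norm u)\<^sup>2) \<le> (1 - \<rho>) * (\<xi>\<^sup>2 + \<zeta>\<^sup>2)"
      using \<rho> by (intro mult_left_mono) auto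
    then show ?thesis using * by (simp add: mult.assoc)
  qed
  moreover have "0 < ?\<epsilon>" using \<rho> eta tau by simp
  ultimately show "\<exists>\<epsilon>>0. \<forall>u. \<epsilon> * (norm u)\<^sup>2 \<le> u \<bullet> M u" by blast
qed

text \<open>\<open>T\<close> is a proximal point step in the metric of \<open>M\<close>: the
  off-diagonal block \<open>- A\<close> produces exactly the extrapolation
  \<open>2 *\<^sub>R x' - x\<close>, and the projection becomes complementarity.\<close>

lemma pdhg_eq_iff:
  "T z = z' \<longleftrightarrow> kkt A (b + snd (M (z' - z))) (c + fst (M (z' - z))) z'"
proof -
  obtain x y x' y' where z: "z = (x, y)" "z' = (x', y')" by (metis surj_pair)
  let ?s = "c + fst (M (z' - z)) + transpose A *v y'"
  have s: "x - \<eta> *\<^sub>R (transpose A *v y) - \<eta> *\<^sub>R c = x' - \<eta> *\<^sub>R ?s"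
    using eta by (simp add: fst_M z algebra_simps)
  have nn: "0 \<le> \<eta> *\<^sub>R ?s \<longleftrightarrow> 0 \<le> ?s"
    using eta by (simp add: nonneg_vec_iff zero_le_mult_iff)
  have "y + \<tau> *\<^sub>R (2 *\<^sub>R p - q) - \<tau> *\<^sub>R b - y' =
      \<tau> *\<^sub>R (p - (b + ((1 / \<tau>) *\<^sub>R (y' - y) - (p - q))))" for p q
    using tau by (simp add: vec_eq_iff field_simps)
  from this[of "A *v x'" "A *v x"]
  have "y + \<tau> *\<^sub>R (A *v (2 *\<^sub>R x' - x)) - \<tau> *\<^sub>R b - y' =
      \<tau> *\<^sub>R (A *v x' - (b + snd (M (z' - z))))"
    by (simp add: snd_M z matrix_vector_mult_diff_distrib matrix_vector_mult_scaleR)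
  then have "y + \<tau> *\<^sub>R (A *v (2 *\<^sub>R x' - x)) - \<tau> *\<^sub>R b = y' \<longleftrightarrow>
      \<tau> *\<^sub>R (A *v x' - (b + snd (M (z' - z)))) = 0"
    by (metis right_minus_eq)
  also have "\<dots> \<longleftrightarrow> A *v x' = b + snd (M (z' - z))"
    using tau by simp
  finally have y: "y + \<tau> *\<^sub>R (A *v (2 *\<^sub>R x' - x)) - \<tau> *\<^sub>R b = y' \<longleftrightarrow> A *v x' = b + snd (M (z' - z))" .
  have "T z = z' \<longleftrightarrow> closest_point {u. 0 \<le> u} (x' - \<eta> *\<^sub>R ?s) = x' \<and>
      y + \<tau> *\<^sub>R (A *v (2 *\<^sub>R x' - x)) - \<tau> *\<^sub>R b = y'"
    unfolding s[symmetric] by (auto simp: z pdhg_def Let_def)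
  also have "\<dots> \<longleftrightarrow> kkt A (b + snd (M (z' - z))) (c + fst (M (z' - z))) z'"
    unfolding closest_point_orthant_eq_iff y nn using eta by (auto simp: kkt_def z(2))
  finally show ?thesis .
qed

text \<open>Monotonicity of the KKT system, applied to the perturbations \<open>M (T z - z)\<close>
  and \<open>M (T z' - z')\<close>, gives the sign of the cross term when \<open>z - z'\<close> is
  split into \<open>T z - T z'\<close> and the rest.\<close>

lemma firmly_nonexpansive:
  "(T z - T z') \<bullet> M (T z - T z') +
     ((z - z') - (T z - T z')) \<bullet> M ((z - z') - (T z - T z')) \<le> (z - z') \<bullet> M (z - z')"
proof -
  let ?d = "z - z'" and ?e = "T z - T z'"
  have "?e \<bullet> (M (T z - z) - M (T z' - z')) \<le> 0"
    by (rule kkt_monotone[of A b _ c]) (simp_all only: pdhg_eq_iff[symmetric])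
  also have "M (T z - z) - M (T z' - z') = M (- (?d - ?e))"
    by (simp add: linear_diff[OF linear_M, symmetric] algebra_simps)
  finally have "0 \<le> ?e \<bullet> M (?d - ?e)"
    by (simp only: linear_neg[OF linear_M] inner_minus_right neg_le_0_iff_le)
  then show ?thesis
    using form_add[of ?e "?d - ?e"] by simp
qed

lemma nonexpansive: "(T z - T z') \<bullet> M (T z - T z') \<le> (z - z') \<bullet> M (z - z')"
  using firmly_nonexpansive[of z z'] nonneg[of "(z - z') - (T z - T z')"] by linarith

section \<open>The set of displacements and its minimal element\<close>

text \<open>Parametrised by the image \<open>z' = T z\<close> instead of \<open>z\<close>, the
  perturbed data depend on \<open>v\<close> alone, so the existence of \<open>z'\<close> is strong
  duality.\<close>

lemma range_displacement:
  "range (\<lambda>z. T z - z) =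
     M -` ({c'. dual_feasible A (c + c')} \<times> {b'. primal_feasible A (b + b')})"
proof (intro set_eqI)
  fix v
  have "v \<in> range (\<lambda>z. T z - z) \<longleftrightarrow> (\<exists>z'. T (z' - v) = z')"
  proof
    assume "v \<in> range (\<lambda>z. T z - z)"
    then obtain z where "v = T z - z" by blast
    then show "\<exists>z'. T (z' - v) = z'" by (intro exI[of _ "T z"]) simp
  next
    assume "\<exists>z'. T (z' - v) = z'"
    then obtain z' where "T (z' - v) = z'" by blast
    then show "v \<in> range (\<lambda>z. T z - z)" by (intro image_eqI[of _ _ "z' - v"]) simp_all
  qed
  also have "\<dots> \<longleftrightarrow> v \<in> M -` ({c'. dual_feasible A (c + c')} \<times> {b'. primal_feasible A (b + b')})"
    using ex_kkt_iff[of A "b + snd (M v)" "c + fst (M v)"]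
    by (simp add: pdhg_eq_iff mem_Times_iff conj_commute del: split_paired_Ex)
  finally show "v \<in> range (\<lambda>z. T z - z) \<longleftrightarrow>
      v \<in> M -` ({c'. dual_feasible A (c + c')} \<times> {b'. primal_feasible A (b + b')})" .
qed

lemma closed_range_displacement: "closed (range (\<lambda>z. T z - z))"
  and convex_range_displacement: "convex (range (\<lambda>z. T z - z))"
proof -
  have "closed ((+) c -` {c'. dual_feasible A c'})" "closed ((+) b -` {b'. primal_feasible A b'})"
    by (intro closed_vimage closed_dual_feasible closed_primal_feasible continuous_intros)+
  then show "closed (range (\<lambda>z. T z - z))"
    unfolding range_displacement
    by (intro closed_vimage closed_Times linear_continuous_on) (auto simp: vimage_def linear_M linear_conv_bounded_linear[symmetric])
  have vimage: "(+) a -` S = (+) (- a) ` S" for a :: "'b::ab_group_add" and S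
    by (force simp: image_iff intro: exI[of _ "a + _"])
  have "convex ((+) c -` {c'. dual_feasible A c'})" "convex ((+) b -` {b'. primal_feasible A b'})"
    unfolding vimage by (intro convex_translation convex_dual_feasible convex_primal_feasible)+
  then show "convex (range (\<lambda>z. T z - z))"
    unfolding range_displacement
    by (intro convex_linear_vimage convex_Times linear_M) (auto simp: vimage_def)
qed

text \<open>The variational inequality for the minimal \<open>M\<close>-norm, tested with perturbations of \<open>M v\<close>.\<close>

definition minimal_displacement :: "(real^'n) \<times> (real^'m) \<Rightarrow> bool" where
  "minimal_displacement v \<longleftrightarrow>
     0 \<le> fst v \<and> A *v fst v = 0 \<and> c \<bullet> fst v \<le> - (fst v \<bullet> fst v) / \<eta> \<and>
     0 \<le> transpose A *v snd v \<and> b \<bullet> snd v \<le> - (snd v \<bullet> snd v) / \<tau>"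

lemma ex_infimal_displacement:
  obtains v z where "infimal_displacement A b c \<eta> \<tau> = v" "T z = z + v" "minimal_displacement v"
proof -
  let ?C = "range (\<lambda>z. T z - z)"
  obtain v where v: "v \<in> ?C" and min: "\<And>w. w \<in> ?C \<Longrightarrow> v \<bullet> M v \<le> w \<bullet> M w"
    using ex_minimizer[OF closed_range_displacement] by blast
  have "infimal_displacement A b c \<eta> \<tau> = v"
    unfolding infimal_displacement_def closure_closed[OF closed_range_displacement] M_norm_def real_sqrt_le_iff
    by (rule the_equality) (use v min minimizer_unique[OF convex_range_displacement _ v] in blast)+
  moreover obtain z where z: "T z = z + v"
  proof -
    from v obtain z where "v = T z - z" by blast
    then show ?thesis using that[of z] by (simp add: algebra_simps)
  qed
  moreover have "minimal_displacement v"
  proof -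
    \<comment> \<open>In the coordinates \<open>(p, q) = M w\<close> the range is a product, so
      costs and right-hand sides can be perturbed independently.\<close>
    have vi: "0 \<le> fst v \<bullet> (p - fst (M v)) + snd v \<bullet> (q - snd (M v))"
      if pq: "dual_feasible A (c + p)" "primal_feasible A (b + q)" for p q
    proof -
      obtain w where w: "M w = (p, q)" using surj_M by (metis surjD)
      then have "w \<in> ?C" using pq unfolding range_displacement by simp
      from minimizer_variational_inequality[OF convex_range_displacement v this min]
      show ?thesis by (simp add: linear_diff[OF linear_M] w inner_prod_def)
    qed
    have "v \<in> M -` ({c'. dual_feasible A (c + c')} \<times> {b'. primal_feasible A (b + b')})"
      using v unfolding range_displacement .
    then have pf: "primal_feasible A (b + snd (M v))" and df: "dual_feasible A (c + fst (M v))"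
      by (auto simp: mem_Times_iff)
    obtain x0 where x0: "A *v x0 = b + snd (M v)" "0 \<le> x0" using pf by (auto simp: primal_feasible_def)
    obtain y0 where y0: "0 \<le> c + fst (M v) + transpose A *v y0" using df by (auto simp: dual_feasible_iff)
    \<comment> \<open>The dual witness \<open>y0 + y\<close> absorbs the term with \<open>y\<close>,
      and \<open>s\<close> only enlarges the slack.\<close>
    have 1: "0 \<le> fst v \<bullet> (s - transpose A *v y)" if "0 \<le> s" for s y
    proof -
      have "dual_feasible A (c + (fst (M v) + (s - transpose A *v y)))"
        unfolding dual_feasible_iff
      proof
        have "c + (fst (M v) + (s - transpose A *v y)) + transpose A *v (y0 + y) =
            (c + fst (M v) + transpose A *v y0) + s"
          by (simp add: algebra_simps)
        moreover have "0 \<le> (c + fst (M v) + transpose A *v y0) + s"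
          using y0 that by (rule add_nonneg_nonneg)
        ultimately show "0 \<le> c + (fst (M v) + (s - transpose A *v y)) + transpose A *v (y0 + y)"
          by (simp only:)
      qed
      from vi[OF this pf] show ?thesis by simp
    qed
    have 2: "0 \<le> snd v \<bullet> (A *v x)" if "0 \<le> x" for x
    proof -
      have "primal_feasible A (b + (snd (M v) + A *v x))"
        unfolding primal_feasible_def
        by (intro exI[of _ "x0 + x"]) (use x0 that in \<open>simp add: algebra_simps\<close>)
      from vi[OF df this] show ?thesis by simp
    qed
    have x: "0 \<le> fst v" using 1[of _ 0] by (intro nonneg_vecI) simp
    have "0 \<le> - ((A *v fst v) \<bullet> (A *v fst v))"
      using 1[of 0 "A *v fst v"] by (simp add: inner_transpose)
    then have Ax: "A *v fst v = 0" by (metis inner_ge_zero inner_eq_zero_iff neg_0_le_iff_le order_antisym)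
    have Ay: "0 \<le> transpose A *v snd v" using 2 by (intro nonneg_vecI) (simp add: inner_transpose')
    \<comment> \<open>Cancelling the data entirely is always feasible; this test yields the
      quantitative bound on \<open>c \<bullet> fst v\<close>, and below the one on
      \<open>b \<bullet> snd v\<close>.\<close>
    have "dual_feasible A (c + (- c))"
      by (auto simp: dual_feasible_def intro: exI[of _ 0])
    from vi[OF this pf] have "c \<bullet> fst v \<le> - (fst v \<bullet> fst v) / \<eta>"
      by (simp add: fst_M inner_diff_right inner_transpose Ax inner_commute[of c])
    moreover have "primal_feasible A (b + (- b))"
      by (auto simp: primal_feasible_def intro: exI[of _ 0])
    from vi[OF df this] have "b \<bullet> snd v \<le> - (snd v \<bullet> snd v) / \<tau>"
      by (simp add: snd_M inner_diff_right Ax inner_commute[of b])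
    ultimately show ?thesis using x Ax Ay by (simp add: minimal_displacement_def)
  qed
  ultimately show thesis using that by blast
qed

section \<open>Translation along the infimal displacement\<close>

lemma M_minimal_displacement:
  assumes "minimal_displacement v"
  shows "fst (M v) = (1 / \<eta>) *\<^sub>R fst v - transpose A *v snd v" "snd (M v) = (1 / \<tau>) *\<^sub>R snd v"
  using assms by (simp_all add: fst_M snd_M minimal_displacement_def)

text \<open>The bounds in \<open>minimal_displacement\<close> oppose the nonnegativity of orthant
  products, so \<open>fst v\<close> is orthogonal to the slack and
  \<open>transpose A *v snd v\<close> to \<open>x\<close>. Hence complementarity persists along the
  whole ray.\<close>

lemma pdhg_translate:
  assumes v: "minimal_displacement v" and z: "T z = z + v" and k: "0 \<le> k"
  shows "T (z + k *\<^sub>R v) = z + k *\<^sub>R v + v"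
proof -
  obtain x y where xy: "z + v = (x, y)" by fastforce
  let ?s = "c + fst (M v) + transpose A *v y"
  have "kkt A (b + snd (M v)) (c + fst (M v)) (z + v)"
    using z by (simp add: pdhg_eq_iff)
  then have kkt: "0 \<le> x" "A *v x = b + snd (M v)" "0 \<le> ?s" "x \<bullet> ?s = 0"
    by (simp_all add: xy kkt_def)
  have V: "0 \<le> fst v" "A *v fst v = 0" "c \<bullet> fst v \<le> - (fst v \<bullet> fst v) / \<eta>"
     "0 \<le> transpose A *v snd v" "b \<bullet> snd v \<le> - (snd v \<bullet> snd v) / \<tau>"
    using v by (auto simp: minimal_displacement_def)
  have "fst v \<bullet> ?s \<le> 0"
    using V by (simp add: M_minimal_displacement[OF v] inner_add_right inner_diff_right inner_transpose inner_commute[of c])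
  then have vs: "fst v \<bullet> ?s = 0" using inner_nonneg_vec[OF V(1) kkt(3)] by simp
  have "x \<bullet> (transpose A *v snd v) \<le> 0"
    using V by (simp add: inner_transpose kkt(2) M_minimal_displacement[OF v] inner_add_left)
  then have xA: "x \<bullet> (transpose A *v snd v) = 0" using inner_nonneg_vec[OF kkt(1) V(4)] by simp
  have s: "c + fst (M v) + transpose A *v (y + k *\<^sub>R snd v) = ?s + k *\<^sub>R (transpose A *v snd v)"
    by (simp add: algebra_simps)
  have "kkt A (b + snd (M v)) (c + fst (M v)) (x + k *\<^sub>R fst v, y + k *\<^sub>R snd v)"
    unfolding kkt_def prod.case s
  proof (intro conjI)
    show "0 \<le> x + k *\<^sub>R fst v" using kkt(1) V(1) k by (simp add: nonneg_vec_iff)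
    show "A *v (x + k *\<^sub>R fst v) = b + snd (M v)" using kkt(2) V(2) by (simp add: algebra_simps)
    show "0 \<le> ?s + k *\<^sub>R (transpose A *v snd v)" using kkt(3) V(4) k by (simp add: nonneg_vec_iff)
    have "(x + k *\<^sub>R u) \<bullet> (s + k *\<^sub>R q) = x \<bullet> s + k * (x \<bullet> q) + k * (u \<bullet> s) + k * k * (u \<bullet> q)"
      for u s q by (simp add: inner_add_left inner_add_right algebra_simps)
    moreover have "fst v \<bullet> (transpose A *v snd v) = 0" by (simp add: inner_transpose V(2))
    ultimately show "(x + k *\<^sub>R fst v) \<bullet> (?s + k *\<^sub>R (transpose A *v snd v)) = 0"
      by (simp only: vs xA kkt(4))
  qed
  also have "(x + k *\<^sub>R fst v, y + k *\<^sub>R snd v) = z + k *\<^sub>R v + v"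
    using xy by (auto simp: prod_eq_iff algebra_simps)
  finally show ?thesis by (simp add: pdhg_eq_iff)
qed

text \<open>Each primal coordinate of the defect is an affine function of \<open>k\<close> clipped
  at 0, minus another affine one, hence eventually affine, and the null subsequence forces it to
  vanish.\<close>

lemma translation_defect_eventually_0:
  assumes v: "minimal_displacement v" and r: "strict_mono r"
    and lim: "(\<lambda>j. T (p + real (r j) *\<^sub>R v) - (p + real (r j) *\<^sub>R v + v)) \<longlonglongrightarrow> 0"
  shows "\<forall>\<^sub>F k in sequentially. T (p + real k *\<^sub>R v) = p + real k *\<^sub>R v + v"
proof -
  define h where "h k = T (p + real k *\<^sub>R v) - (p + real k *\<^sub>R v + v)" for k :: nat
  have lim_h: "(\<lambda>j. h (r j)) \<longlonglongrightarrow> 0" using lim by (simp add: h_def)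
  have Av: "A *v fst v = 0" using v by (simp add: minimal_displacement_def)
  have "\<forall>\<^sub>F k in sequentially. fst (h k) $ i = 0" for i
  proof -
    define w where "w = (fst p - \<eta> *\<^sub>R (transpose A *v snd p) - \<eta> *\<^sub>R c) $ i"
    define g where "g = (fst v - \<eta> *\<^sub>R (transpose A *v snd v)) $ i"
    have h_i: "fst (h k) $ i = max 0 (w + real k * g) - ((fst p + fst v) $ i + real k * fst v $ i)" for k
      by (simp add: h_def pdhg_def split_beta Let_def closest_point_orthant w_def g_def algebra_simps)
    obtain \<alpha> \<beta> where "\<forall>\<^sub>F k in sequentially. max 0 (w + real k * g) = \<alpha> + real k * \<beta>"
      using eventually_max_0_affine by blast
    then have "\<forall>\<^sub>F k in sequentially. fst (h k) $ i = (\<alpha> - (fst p + fst v) $ i) + real k * (\<beta> - fst v $ i)"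
      by eventually_elim (simp add: h_i algebra_simps)
    moreover have "(\<lambda>j. fst (h (r j)) $ i) \<longlonglongrightarrow> 0"
      using tendsto_vec_nth[OF tendsto_fst[OF lim_h], of i] by simp
    ultimately show ?thesis
      using eventually_affine_tendsto_0[OF _ r, of "\<lambda>k. fst (h k) $ i"] by simp
  qed
  then have fst_h: "\<forall>\<^sub>F k in sequentially. fst (h k) = 0"
    by (simp add: vec_eq_iff eventually_all_finite)
  \<comment> \<open>Once the primal defect is 0, \<open>A *v fst v = 0\<close> makes the dual defect
    independent of \<open>k\<close>.\<close>
  define C where "C = \<tau> *\<^sub>R (A *v fst p) - \<tau> *\<^sub>R b - snd v"
  have snd_h: "\<forall>\<^sub>F k in sequentially. snd (h k) = C"
    using fst_h
  proof eventually_elim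
    case (elim k)
    let ?x = "fst p + real k *\<^sub>R fst v"
    have x: "fst (T (p + real k *\<^sub>R v)) = ?x + fst v"
      using elim by (simp add: h_def)
    have "snd (T (p + real k *\<^sub>R v)) =
        snd p + real k *\<^sub>R snd v + \<tau> *\<^sub>R (A *v (2 *\<^sub>R fst (T (p + real k *\<^sub>R v)) - ?x)) - \<tau> *\<^sub>R b"
      by (simp add: pdhg_def split_beta Let_def)
    also have "A *v (2 *\<^sub>R fst (T (p + real k *\<^sub>R v)) - ?x) = A *v fst p"
    proof -
      have x2: "2 *\<^sub>R (?x + fst v) - ?x = fst p + (real k + 2) *\<^sub>R fst v"
        by (simp add: vec_eq_iff algebra_simps)
      show ?thesis
        unfolding x x2 by (simp add: matrix_vector_right_distrib matrix_vector_mult_scaleR Av)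
    qed
    finally show ?case by (simp add: h_def C_def)
  qed
  have "(\<lambda>j. snd (h (r j))) \<longlonglongrightarrow> C"
    using eventually_compose_filterlim[OF snd_h filterlim_subseq[OF r]] by (rule tendsto_eventually)
  moreover have "(\<lambda>j. snd (h (r j))) \<longlonglongrightarrow> 0" using tendsto_snd[OF lim_h] by simp
  ultimately have "C = 0" using LIMSEQ_unique by fastforce
  have "\<forall>\<^sub>F k in sequentially. h k = 0"
    using fst_h snd_h by eventually_elim (simp add: prod_eq_iff \<open>C = 0\<close>)
  then show ?thesis by (simp add: h_def)
qed

text \<open>Fejer monotonicity is used twice: about the orbit through \<open>z0\<close>, for
  boundedness and vanishing increments, and then about the orbit through a cluster point. The second
  orbit is shown to be exact only for large indices, hence the offset \<open>K\<close>.\<close>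

lemma iterates_minus_drift_converge:
  assumes v: "minimal_displacement v" and z0: "T z0 = z0 + v"
    and iter: "\<And>k. w (Suc k) = T (w k)"
  obtains z' and K :: nat where "(\<lambda>k. w k - real k *\<^sub>R v) \<longlonglongrightarrow> z'"
    and "T (z' + real K *\<^sub>R v) = z' + real K *\<^sub>R v + v"
proof -
  define d where "d k = w k - (z0 + real k *\<^sub>R v)" for k
  have d_Suc: "d (Suc k) = T (w k) - T (z0 + real k *\<^sub>R v)" for k
    using pdhg_translate[OF v z0, of "real k"] by (simp add: d_def iter algebra_simps)
  have step_d: "d (Suc k) \<bullet> M (d (Suc k)) + (d k - d (Suc k)) \<bullet> M (d k - d (Suc k)) \<le> d k \<bullet> M (d k)" for k
    using firmly_nonexpansive[of "w k" "z0 + real k *\<^sub>R v"] unfolding d_Suc[symmetric] d_def[of k, symmetric] .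
  have dec: "d (Suc k) \<bullet> M (d (Suc k)) \<le> d k \<bullet> M (d k)" for k
    using step_d[of k] nonneg[of "d k - d (Suc k)"] by linarith
  then have decseq: "decseq (\<lambda>k. d k \<bullet> M (d k))" by (rule decseq_SucI)
  obtain l where l: "(\<lambda>k. d k \<bullet> M (d k)) \<longlonglongrightarrow> l"
    by (rule decseq_convergent[OF decseq, of 0]) (auto simp: nonneg)
  have "(\<lambda>k. d k \<bullet> M (d k) - d (Suc k) \<bullet> M (d (Suc k))) \<longlonglongrightarrow> l - l"
    by (intro tendsto_diff l LIMSEQ_Suc[OF l])
  then have lim0: "(\<lambda>k. d k \<bullet> M (d k) - d (Suc k) \<bullet> M (d (Suc k))) \<longlonglongrightarrow> 0" by simp
  have "(d k - d (Suc k)) \<bullet> M (d k - d (Suc k)) \<le> d k \<bullet> M (d k) - d (Suc k) \<bullet> M (d (Suc k))" for k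
    using step_d[of k] by linarith
  then have "(\<lambda>k. (d k - d (Suc k)) \<bullet> M (d k - d (Suc k))) \<longlonglongrightarrow> 0"
    by (intro tendsto_sandwich[OF _ _ tendsto_const lim0] always_eventually allI nonneg)
  then have diff: "(\<lambda>k. d k - d (Suc k)) \<longlonglongrightarrow> 0" by (simp only: tendsto_0_iff)
  obtain B where B: "\<And>u. u \<bullet> M u \<le> d 0 \<bullet> M (d 0) \<Longrightarrow> norm u \<le> B" using bounded_form by blast
  have "bounded (range d)"
    using decseqD[OF decseq, of 0] by (intro boundedI[of _ B]) (auto intro: B)
  then obtain D r where r: "strict_mono r" and "(d \<circ> r) \<longlonglongrightarrow> D"
    using bounded_imp_convergent_subsequence by blast
  then have dr: "(\<lambda>j. d (r j) - D) \<longlonglongrightarrow> 0" by (simp add: o_def LIM_zero_iff)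
  define p where "p = z0 + D"
  have p: "w k - (p + real k *\<^sub>R v) = d k - D" for k by (simp add: p_def d_def)
  have dr0: "(\<lambda>j. (d (r j) - D) \<bullet> M (d (r j) - D)) \<longlonglongrightarrow> 0" using dr by (simp only: tendsto_0_iff)
  have "(T (w k) - T (p + real k *\<^sub>R v)) \<bullet> M (T (w k) - T (p + real k *\<^sub>R v)) \<le> (d k - D) \<bullet> M (d k - D)" for k
    using nonexpansive[of "w k" "p + real k *\<^sub>R v"] unfolding p .
  then have "(\<lambda>j. (T (w (r j)) - T (p + real (r j) *\<^sub>R v)) \<bullet> M (T (w (r j)) - T (p + real (r j) *\<^sub>R v))) \<longlonglongrightarrow> 0"
    by (intro tendsto_sandwich[OF _ _ tendsto_const dr0] always_eventually allI nonneg)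
  then have "(\<lambda>j. T (w (r j)) - T (p + real (r j) *\<^sub>R v)) \<longlonglongrightarrow> 0" by (simp only: tendsto_0_iff)
  \<comment> \<open>The defect combines three null sequences: the distance to the cluster point, the
    increment of \<open>d\<close>, and the difference of the images under \<open>T\<close>.\<close>
  from tendsto_diff[OF tendsto_diff[OF dr LIMSEQ_subseq_LIMSEQ[OF diff r, unfolded o_def]] this]
  have "(\<lambda>j. T (p + real (r j) *\<^sub>R v) - (p + real (r j) *\<^sub>R v + v)) \<longlonglongrightarrow> 0"
    by (simp add: d_def p_def iter algebra_simps)
  from translation_defect_eventually_0[OF v r this] obtain K where K: "\<And>k. K \<le> k \<Longrightarrow> T (p + real k *\<^sub>R v) = p + real k *\<^sub>R v + v"
    unfolding eventually_sequentially by blast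
  \<comment> \<open>From \<open>K\<close> on the orbit through \<open>p\<close> is exact, so the
    distance to \<open>D\<close> decreases; its limit can be read off along
    \<open>r\<close>.\<close>
  have mono: "(d (Suc k) - D) \<bullet> M (d (Suc k) - D) \<le> (d k - D) \<bullet> M (d k - D)" if "K \<le> k" for k
  proof -
    have "T (w k) - T (p + real k *\<^sub>R v) = d (Suc k) - D"
      using p[of "Suc k"] by (simp add: K[OF that] iter algebra_simps)
    then show ?thesis using nonexpansive[of "w k" "p + real k *\<^sub>R v"] p[of k] by simp
  qed
  have decseq': "decseq (\<lambda>k. (d (k + K) - D) \<bullet> M (d (k + K) - D))"
    by (intro decseq_SucI) (simp add: mono)
  obtain l' where "(\<lambda>k. (d (k + K) - D) \<bullet> M (d (k + K) - D)) \<longlonglongrightarrow> l'"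
    by (rule decseq_convergent[OF decseq', of 0]) (auto simp: nonneg)
  then have l': "(\<lambda>k. (d k - D) \<bullet> M (d k - D)) \<longlonglongrightarrow> l'"
    by (rule LIMSEQ_offset)
  have "l' = 0"
    using LIMSEQ_unique[OF LIMSEQ_subseq_LIMSEQ[OF l' r, unfolded o_def] dr0] .
  with l' have "(\<lambda>k. d k - D) \<longlonglongrightarrow> 0" by (simp only: tendsto_0_iff)
  from tendsto_add[OF this tendsto_const[of p]]
  have "(\<lambda>k. w k - real k *\<^sub>R v) \<longlonglongrightarrow> p" by (simp add: d_def p_def algebra_simps)
  then show thesis using that K[OF order_refl] by blast
qed

section \<open>Feasibility read off from the displacement\<close>

text \<open>A dual feasible point forces \<open>c \<bullet> fst v \<ge> 0\<close>, against the
  quadratic upper bound. Conversely, if \<open>fst v = 0\<close> the cost is perturbed by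
  \<open>- (transpose A *v snd v)\<close> only, which a shift of the multiplier absorbs.\<close>

lemma dual_feasible_iff_displacement:
  assumes v: "minimal_displacement v" and z: "T z = z + v"
  shows "dual_feasible A c \<longleftrightarrow> fst v = 0"
proof
  assume "dual_feasible A c"
  then obtain y where "0 \<le> c + transpose A *v y" by (auto simp: dual_feasible_iff)
  then have "0 \<le> c \<bullet> fst v"
    using v inner_nonneg_vec[of "fst v" "c + transpose A *v y"]
    by (simp add: minimal_displacement_def inner_add_right inner_transpose inner_commute[of c])
  then have "fst v \<bullet> fst v / \<eta> \<le> 0"
    using v by (simp add: minimal_displacement_def)
  then show "fst v = 0" using eta inner_ge_zero[of "fst v"] by (simp add: divide_le_0_iff)
next
  assume 0: "fst v = 0"
  have "kkt A (b + snd (M v)) (c + fst (M v)) (z + v)"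
    using z by (simp add: pdhg_eq_iff)
  then have "dual_feasible A (c + fst (M v))" using ex_kkt_iff by blast
  then obtain y where "0 \<le> c - transpose A *v snd v + transpose A *v y"
    by (auto simp: dual_feasible_iff fst_M 0)
  then have "0 \<le> c + transpose A *v (y - snd v)" by (simp add: algebra_simps)
  then show "dual_feasible A c" by (auto simp: dual_feasible_iff)
qed

text \<open>A primal feasible point forces \<open>b \<bullet> snd v \<ge> 0\<close>. Conversely, the
  right-hand side is perturbed by a multiple of \<open>snd v\<close>, so it is unperturbed when
  \<open>snd v = 0\<close>.\<close>

lemma primal_feasible_iff_displacement:
  assumes v: "minimal_displacement v" and z: "T z = z + v"
  shows "primal_feasible A b \<longleftrightarrow> snd v = 0"
proof
  assume "primal_feasible A b"
  then obtain x where "A *v x = b" "0 \<le> x" by (auto simp: primal_feasible_def)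
  then have "0 \<le> b \<bullet> snd v"
    using v inner_nonneg_vec[of x "transpose A *v snd v"]
    by (simp add: minimal_displacement_def inner_transpose)
  then have "snd v \<bullet> snd v / \<tau> \<le> 0"
    using v by (simp add: minimal_displacement_def)
  then show "snd v = 0" using tau inner_ge_zero[of "snd v"] by (simp add: divide_le_0_iff)
next
  assume 0: "snd v = 0"
  have "kkt A (b + snd (M v)) (c + fst (M v)) (z + v)"
    using z by (simp add: pdhg_eq_iff)
  then have "primal_feasible A (b + snd (M v))" using ex_kkt_iff by blast
  then show "primal_feasible A b" by (simp add: M_minimal_displacement[OF v] 0)
qed

lemma dual_infeasibility_certificate_displacement:
  assumes "minimal_displacement v" "fst v \<noteq> 0"
  shows "dual_infeasibility_certificate A c (fst v)"
proof -
  have "0 < fst v \<bullet> fst v / \<eta>" using assms(2) eta by simp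
  then show ?thesis using assms(1)
    by (simp add: minimal_displacement_def dual_infeasibility_certificate_def)
qed

lemma primal_infeasibility_certificate_displacement:
  assumes "minimal_displacement v" "snd v \<noteq> 0"
  shows "primal_infeasibility_certificate A b (snd v)"
proof -
  have "0 < snd v \<bullet> snd v / \<tau>" using assms(2) tau by simp
  then show ?thesis using assms(1)
    by (simp add: minimal_displacement_def primal_infeasibility_certificate_def)
qed

end

theorem theorem4:
  fixes A :: "real^'n^'m" and b :: "real^'m" and c :: "real^'n"
    and \<eta> \<tau> :: real
    and z :: "nat \<Rightarrow> (real^'n) \<times> (real^'m)"
    and v\<^sub>x :: "real^'n" and v\<^sub>y :: "real^'m"
  assumes "\<eta> > 0" and "\<tau> > 0"
    and "\<eta> * \<tau> * (onorm ((*v) A))\<^sup>2 < 1"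
    and "(v\<^sub>x, v\<^sub>y) = infimal_displacement A b c \<eta> \<tau>"
    and "\<And>k. z (Suc k) = pdhg A b c \<eta> \<tau> (z k)"
  shows
    "(primal_feasible A b \<and> dual_feasible A c \<longrightarrow>
        (\<exists>z'. primal_dual_solution A b c z' \<and> z \<longlonglongrightarrow> z' \<and>
           (v\<^sub>x, v\<^sub>y) = pdhg A b c \<eta> \<tau> z' - z' \<and> pdhg A b c \<eta> \<tau> z' - z' = 0))
   \<and> (\<not> primal_feasible A b \<and> \<not> dual_feasible A c \<longrightarrow>
        filterlim (\<lambda>k. fst (z k)) at_infinity sequentially \<and>
        filterlim (\<lambda>k. snd (z k)) at_infinity sequentially \<and>
        dual_infeasibility_certificate A c v\<^sub>x \<and>
        primal_infeasibility_certificate A b v\<^sub>y)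
   \<and> (\<not> primal_feasible A b \<and> dual_feasible A c \<longrightarrow>
        filterlim (\<lambda>k. snd (z k)) at_infinity sequentially \<and>
        primal_infeasibility_certificate A b v\<^sub>y \<and>
        (\<exists>x'. (\<lambda>k. fst (z k)) \<longlonglongrightarrow> x' \<and>
           (\<exists>y'. (v\<^sub>x, v\<^sub>y) = pdhg A b c \<eta> \<tau> (x', y') - (x', y'))))
   \<and> (primal_feasible A b \<and> \<not> dual_feasible A c \<longrightarrow>
        filterlim (\<lambda>k. fst (z k)) at_infinity sequentially \<and>
        dual_infeasibility_certificate A c v\<^sub>x \<and>
        (\<exists>y'. (\<lambda>k. snd (z k)) \<longlonglongrightarrow> y' \<and>
           (\<exists>x'. (v\<^sub>x, v\<^sub>y) = pdhg A b c \<eta> \<tau> (x', y') - (x', y'))))"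
proof -
  interpret pdhg_steps A b c \<eta> \<tau>
    using assms(1-3) by unfold_locales
  define v where "v = (v\<^sub>x, v\<^sub>y)"
  obtain z0 where st: "minimal_displacement v" and z0: "T z0 = z0 + v"
    using ex_infimal_displacement assms(4) unfolding v_def by metis
  obtain z' and K :: nat where lim: "(\<lambda>k. z k - real k *\<^sub>R v) \<longlonglongrightarrow> z'"
    and K: "T (z' + real K *\<^sub>R v) = z' + real K *\<^sub>R v + v"
    using iterates_minus_drift_converge[where w = z, OF st z0 assms(5)] by blast
  have limx: "(\<lambda>k. fst (z k) - real k *\<^sub>R v\<^sub>x) \<longlonglongrightarrow> fst z'"
    using tendsto_fst[OF lim] by (simp add: v_def)
  have limy: "(\<lambda>k. snd (z k) - real k *\<^sub>R v\<^sub>y) \<longlonglongrightarrow> snd z'"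
    using tendsto_snd[OF lim] by (simp add: v_def)
  have df: "dual_feasible A c \<longleftrightarrow> v\<^sub>x = 0"
    using dual_feasible_iff_displacement[OF st z0] by (simp add: v_def)
  have pf: "primal_feasible A b \<longleftrightarrow> v\<^sub>y = 0"
    using primal_feasible_iff_displacement[OF st z0] by (simp add: v_def)
  have divx: "filterlim (\<lambda>k. fst (z k)) at_infinity sequentially" if "v\<^sub>x \<noteq> 0"
    using filterlim_at_infinity_linear_drift[OF limx that] .
  have divy: "filterlim (\<lambda>k. snd (z k)) at_infinity sequentially" if "v\<^sub>y \<noteq> 0"
    using filterlim_at_infinity_linear_drift[OF limy that] .
  have certx: "dual_infeasibility_certificate A c v\<^sub>x" if "v\<^sub>x \<noteq> 0"
    using dual_infeasibility_certificate_displacement[OF st] that by (simp add: v_def)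
  have certy: "primal_infeasibility_certificate A b v\<^sub>y" if "v\<^sub>y \<noteq> 0"
    using primal_infeasibility_certificate_displacement[OF st] that by (simp add: v_def)
  \<comment> \<open>This point realises the displacement. In a component where \<open>v\<close>
    vanishes it agrees with \<open>z'\<close>, that is, with the limit of the iterates in that
    component.\<close>
  have K': "(v\<^sub>x, v\<^sub>y) = T (z' + real K *\<^sub>R v) - (z' + real K *\<^sub>R v)"
    using K by (simp add: v_def)
  have "\<exists>z'. primal_dual_solution A b c z' \<and> z \<longlonglongrightarrow> z' \<and> (v\<^sub>x, v\<^sub>y) = T z' - z' \<and> T z' - z' = 0"
    if "v\<^sub>x = 0" "v\<^sub>y = 0"
  proof -
    have v0: "v = 0" using that by (simp add: v_def prod_eq_iff)
    then have Tz': "T z' = z'" using K by simp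
    then have "kkt A b c z'" by (simp add: pdhg_eq_iff linear_0[OF linear_M])
    moreover have "z \<longlonglongrightarrow> z'" using lim by (simp add: v0)
    ultimately have "primal_dual_solution A b c z' \<and> z \<longlonglongrightarrow> z' \<and> (v\<^sub>x, v\<^sub>y) = T z' - z' \<and> T z' - z' = 0"
      using kkt_imp_primal_dual_solution[of A b c z'] Tz' v0 by (simp add: v_def)
    then show ?thesis ..
  qed
  moreover have "(\<lambda>k. fst (z k)) \<longlonglongrightarrow> fst z' \<and> (\<exists>y'. (v\<^sub>x, v\<^sub>y) = T (fst z', y') - (fst z', y'))"
    if "v\<^sub>x = 0"
  proof -
    have "z' + real K *\<^sub>R v = (fst z', snd z' + real K *\<^sub>R v\<^sub>y)"
      by (simp add: prod_eq_iff v_def that)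
    then show ?thesis using limx K' that by auto
  qed
  moreover have "(\<lambda>k. snd (z k)) \<longlonglongrightarrow> snd z' \<and> (\<exists>x'. (v\<^sub>x, v\<^sub>y) = T (x', snd z') - (x', snd z'))"
    if "v\<^sub>y = 0"
  proof -
    have "z' + real K *\<^sub>R v = (fst z' + real K *\<^sub>R v\<^sub>x, snd z')"
      by (simp add: prod_eq_iff v_def that)
    then show ?thesis using limy K' that by auto
  qed
  ultimately show ?thesis
    unfolding pf df using divx divy certx certy by blast
qed

end
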